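(* For every even integer $n \ge 174$, $D(n) \ge n/2 + 1$.
   Context: Let $P$ be a finite set of points in the plane. A disk (of positive radius) is empty (with respect to $P$) if its interior contains no point of $P$. Disks are called pairwise-disjoint if their interiors are pairwise disjoint (so two disks may touch at a common boundary point). $D(P)$ is the minimum number of disks in a family of pairwise-disjoint empty disks such that each point of $P$ lies on the boundary of at least one disk of the family. $D(n)$ is the maximum of $D(P)$ over all sets $P$ of $n$ points in the plane. *)

theory Defs
  imports "HOL-Analysis.Analysis"
begin

definition is_disk :: "(real ^ 2) set \<Rightarrow> bool" where
  "is_disk B \<longleftrightarrow> (\<exists>c r. r > 0 \<and> B = cball c r)"

definition empty_disk :: "(real ^ 2) set \<Rightarrow> (real ^ 2) set \<Rightarrow> bool" where
  "empty_disk P B \<longleftrightarrow> is_disk B \<and> interior B \<inter> P = {}"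

definition disjoint_disks :: "(real ^ 2) set set \<Rightarrow> bool" where
  "disjoint_disks F \<longleftrightarrow> pairwise (\<lambda>A B. interior A \<inter> interior B = {}) F"

definition covering_family :: "(real ^ 2) set \<Rightarrow> (real ^ 2) set set \<Rightarrow> bool" where
  "covering_family P F \<longleftrightarrow>
     (\<forall>B\<in>F. empty_disk P B) \<and> disjoint_disks F \<and> (\<forall>p\<in>P. \<exists>B\<in>F. p \<in> frontier B)"

(* Finiteness is required because the cardinality of an infinite set is 0. *)
definition D_set :: "(real ^ 2) set \<Rightarrow> nat" where
  "D_set P = (LEAST k. \<exists>F. finite F \<and> card F = k \<and> covering_family P F)"

(* The set of values is finite: it is bounded by n, taking one small disk per point. *)
definition D :: "nat \<Rightarrow> nat" where
  "D n = Max {D_set P | P. finite P \<and> card P = n}"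

end

(* The extremal set is a regular N-gon (N = n - 1 odd) on the unit circle together with its centre O.
   An empty disk touches at most two vertices, and then two neighbouring ones.  If (N + 1)/2 disks
   sufficed, then, up to one unit of slack, the vertices would be matched into neighbouring pairs.
   The disk B touching O and a vertex v is almost internally tangent to the unit circle at v, and on
   at least one side of v the next four vertices v+1, ..., v+4 are matched as {v+1, v+2} and
   {v+3, v+4}.  Staying disjoint from B forces these two disks to bulge outwards so far that they
   overlap as soon as N >= 173. *)
theory Submission
  imports Defs
begin

section \<open>Two outer disks squeezed by an inner disk\<close>

text \<open>Why staying disjoint from B forces bulging: a disk through two neighbouring vertices
  that enters only slightly below their chord must be large, since depth times height is the square
  of the half chord \<open>s = sin (\<theta> / 2)\<close>. The room that B leaves is of second order
  in the angle: for a pair with centre at distance rho from O and far vertex j steps from v, the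
  depth is at most (cos \<theta> - cos (j \<theta>)) rho \<le> 2 (j^2 - 1) s^2 rho, and j = 2, 4
  give the constants 6 and 30. Writing the two depths as s v and s w, this reads roughly v \<le> 6 s
  and w \<le> 30 s, while 16 v w < 1 makes the disks overlap. In this crude form the threshold would
  be near N = 169; the correction terms account for the distance to 173. On the combinatorial side,
  (N + 1)/2 disks offer N + 1 contacts for N vertices, so a single defect may sit anywhere. It
  cannot spoil both sides of B at once.\<close>

lemma less_one_of_quadratic_bound:
  fixes s v K :: real
  assumes "0 < s" "K < 1" "0 < v" and h: "v\<^sup>2 \<le> K * (v + s * (1 - v\<^sup>2) / 2)"
    and "0 \<le> K"
  shows "v < 1"
proof (rule ccontr)
  assume "\<not> v < 1"
  then have v: "v \<le> v\<^sup>2" "1 \<le> v\<^sup>2"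
    using mult_mono[of 1 v 1 v] mult_right_mono[of 1 v v] by (auto simp: power2_eq_square)
  then have "s * (1 - v\<^sup>2) / 2 \<le> 0" using assms by (simp add: mult_nonneg_nonpos)
  then have "K * (v + s * (1 - v\<^sup>2) / 2) \<le> K * v" using assms by (intro mult_left_mono) auto
  also have "\<dots> < 1 * v" using assms by (intro mult_strict_right_mono) auto
  finally show False using h v by linarith
qed

text \<open>The bound on \<open>s\<close> is \<open>pi / 173\<close> rounded up. The two sides differ by less than one
  percent at the extreme values \<open>v = 0.1174\<close> and \<open>w = 0.5511\<close>, so the decimal constants below
  cannot be coarsened much.\<close>
lemma cap_widths_inequality:
  fixes s v w :: real
  assumes s: "0 < s" "s \<le> (1816/100000)" and v: "0 < v" and w: "0 < w"
    and hv: "v\<^sup>2 \<le> 6 * s * (v + s * (1 - v\<^sup>2) / 2)"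
    and hw: "w\<^sup>2 \<le> 30 * s * (w + s * (1 - w\<^sup>2) / 2)"
  shows "16 * (v + s * (1 - v\<^sup>2) / 2) * (w + s * (1 - w\<^sup>2) / 2) < (1 + v * w)\<^sup>2"
proof -
  \<comment> \<open>Half the upper bound on \<open>s\<close>. Likewise 0.10896 and 0.5448 below are
    6 and 30 times that bound.\<close>
  define h :: real where "h = (908/100000)"
  have s2: "s * x / 2 \<le> h * x" if "0 \<le> x" for x
    using mult_right_mono[OF s(2) that] by (simp add: h_def)
  \<comment> \<open>0.1174 lies just above the positive root of the quadratic obtained at the
    largest \<open>s\<close>, and 0.5511 is found in the same way for \<open>w\<close>. That
    \<open>v < 1\<close> comes first because replacing \<open>s\<close> by its bound in
    \<open>s * (1 - v\<^sup>2)\<close> needs a nonnegative factor.\<close>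
  have v1: "v \<le> (1174/10000)"
  proof (rule ccontr)
    assume "\<not> v \<le> (1174/10000)"
    then have a: "v > (1174/10000)" by simp
    have "v < 1" using less_one_of_quadratic_bound[OF s(1) _ _ hv] s v by auto
    then have "v\<^sup>2 < 1" using v by (simp add: abs_square_less_1)
    have "v\<^sup>2 \<le> 6 * s * (v + h * (1 - v\<^sup>2))"
      using hv s2[of "1 - v\<^sup>2"] \<open>v\<^sup>2 < 1\<close> s by (smt (verit) mult_left_mono)
    also have "\<dots> \<le> (10896/100000) * (v + h * (1 - v\<^sup>2))"
      using s v \<open>v\<^sup>2 < 1\<close> by (intro mult_right_mono) (auto simp: h_def)
    also have "\<dots> \<le> (10896/100000) * v + (98936/100000000)"
      by (simp add: h_def) (use zero_le_power2[of v] in linarith)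
    finally have "v * (v - (10896/100000)) \<le> (98936/100000000)" by (simp add: power2_eq_square algebra_simps)
    moreover have "v * (v - (10896/100000)) \<ge> (1174/10000) * ((1174/10000) - (10896/100000))"
      using a by (intro mult_mono) auto
    ultimately show False by simp
  qed
  have w1: "w \<le> (5511/10000)"
  proof (rule ccontr)
    assume "\<not> w \<le> (5511/10000)"
    then have a: "w > (5511/10000)" by simp
    have "w < 1" using less_one_of_quadratic_bound[OF s(1) _ _ hw] s w by simp
    then have "w\<^sup>2 < 1" using w by (simp add: abs_square_less_1)
    have "w\<^sup>2 \<le> 30 * s * (w + h * (1 - w\<^sup>2))"
      using hw s2[of "1 - w\<^sup>2"] \<open>w\<^sup>2 < 1\<close> s by (smt (verit) mult_left_mono)
    also have "\<dots> \<le> (5448/10000) * (w + h * (1 - w\<^sup>2))"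
      using s w \<open>w\<^sup>2 < 1\<close> by (intro mult_right_mono) (auto simp: h_def)
    finally have "w * ((1004946784/1000000000) * w - (5448/10000)) \<le> (4946784/1000000000)"
      by (simp add: power2_eq_square field_simps h_def)
    moreover have "w * ((1004946784/1000000000) * w - (5448/10000)) \<ge> (5511/10000) * ((1004946784/1000000000) * (5511/10000) - (5448/10000))"
      using a by (intro mult_mono) auto
    ultimately show False by simp
  qed
  \<comment> \<open>For \<open>w\<close> the correction \<open>1 - w\<^sup>2\<close> is kept, as
    \<open>w\<close> can be large; for \<open>v\<close> it is bounded by 1.\<close>
  define f where "f = w + h * (1 - w\<^sup>2)"
  have "w\<^sup>2 \<le> (5511/10000)\<^sup>2" using w w1 by (intro power_mono) auto
  then have w2: "w\<^sup>2 \<le> (31/100)" by (simp add: power2_eq_square)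
  have "v\<^sup>2 \<le> (1174/10000)\<^sup>2" using v v1 by (intro power_mono) auto
  then have v2: "v\<^sup>2 \<le> (2/100)" by (simp add: power2_eq_square)
  have fw: "w \<le> f" using w2 by (simp add: f_def h_def)
  have "16 * (v + s * (1 - v\<^sup>2) / 2) * (w + s * (1 - w\<^sup>2) / 2) \<le> 16 * (v + h) * f"
  proof (intro mult_mono)
    have "s * (1 - v\<^sup>2) / 2 \<le> h * (1 - v\<^sup>2)" using s2 v2 by simp
    also have "\<dots> \<le> h" by (simp add: h_def)
    finally show "v + s * (1 - v\<^sup>2) / 2 \<le> v + h" by simp
    show "w + s * (1 - w\<^sup>2) / 2 \<le> f" using s2[of "1 - w\<^sup>2"] w2 by (simp add: f_def)
    show "0 \<le> 16 * (v + h)" "0 \<le> w + s * (1 - w\<^sup>2) / 2" using v w w2 s by (auto simp: h_def)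
  qed (use v v2 s in auto)
  \<comment> \<open>Of the square on the right only \<open>1 + 2 * v * w\<close> is used. What
    remains increases in \<open>v\<close>, because \<open>w \<le> f\<close>, and then in
    \<open>w\<close>, so the two extreme values decide.\<close>
  also have "\<dots> = v * (16 * f - 2 * w) + 16 * h * f + 2 * v * w" by (simp add: algebra_simps)
  also have "\<dots> < 1 + 2 * v * w"
  proof -
    have e1: "v * (16 * f - 2 * w) \<le> 1174/10000 * (16 * f - 2 * w)"
      using v v1 fw w by (intro mult_right_mono) auto
    have e2: "1174/10000 * (16 * f - 2 * w) + 16 * h * f = 202368/100000 * f - 2348/10000 * w"
      by (simp add: h_def field_simps)
    have e3: "202368/100000 * f - 2348/10000 * w \<le> w * (178888/100000 - 183750144/10000000000 * w) + 183750144/10000000000"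
      by (simp add: f_def h_def power2_eq_square field_simps)
    have e4: "w * (178888/100000 - 183750144/10000000000 * w)
        \<le> 5511/10000 * (178888/100000 - 183750144/10000000000 * (5511/10000))"
    proof -
      have "5511/10000 * (178888/100000 - 183750144/10000000000 * (5511/10000)) - w * (178888/100000 - 183750144/10000000000 * w)
         = (5511/10000 - w) * (178888/100000 - 183750144/10000000000 * (5511/10000 + w))"
        by (simp add: field_simps)
      also have "\<dots> \<ge> 0" using w w1 by (intro mult_nonneg_nonneg) auto
      finally show ?thesis by simp
    qed
    have "v * (16 * f - 2 * w) + 16 * h * f \<le> 1174/10000 * (16 * f - 2 * w) + 16 * h * f"
      by (rule add_right_mono[OF e1])
    also note e2
    also note e3
    also note add_right_mono[OF e4]
    also have "5511/10000 * (178888/100000 - 183750144/10000000000 * (5511/10000)) + 183750144/10000000000 < (1::real)"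
      by simp
    finally show ?thesis by simp
  qed
  also have "\<dots> \<le> 1 + 2 * v * w + (v * w)\<^sup>2" by simp
  also have "\<dots> = (1 + v * w)\<^sup>2" by (simp add: power2_eq_square algebra_simps)
  finally show ?thesis .
qed

text \<open>With \<open>s\<close> and \<open>C\<close> the sine and cosine of half the central
  angle, \<open>1 - 8 * s\<^sup>2 * C\<^sup>2\<close> is the cosine of twice that angle, so the left
  side is the squared distance of two centres seen from the origin under twice the central angle.
  Multiplying the separation inequality by \<open>w1 * w2\<close> and using \<open>u * w = 1\<close>
  leaves an inequality in the depths alone.\<close>

lemma outer_disks_overlap:
  fixes s C r1 r2 \<rho>1 \<rho>2 :: real
  assumes s: "0 < s" "s \<le> 1816/100000" and C: "0 < C" "C\<^sup>2 + s\<^sup>2 = 1"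
    and pos: "0 < r1" "0 < r2" "0 < \<rho>1" "0 < \<rho>2"
    and r1: "r1\<^sup>2 = \<rho>1\<^sup>2 + 1 - 2 * \<rho>1 * C" "r1 \<le> (1 + 6 * s\<^sup>2) * \<rho>1 - C"
    and r2: "r2\<^sup>2 = \<rho>2\<^sup>2 + 1 - 2 * \<rho>2 * C" "r2 \<le> (1 + 30 * s\<^sup>2) * \<rho>2 - C"
  shows "\<rho>1\<^sup>2 + \<rho>2\<^sup>2 - 2 * \<rho>1 * \<rho>2 * (1 - 8 * s\<^sup>2 * C\<^sup>2) < (r1 + r2)\<^sup>2"
proof (rule ccontr)
  assume "\<not> ?thesis"
  then have d: "(r1 + r2)\<^sup>2 \<le> \<rho>1\<^sup>2 + \<rho>2\<^sup>2 - 2 * \<rho>1 * \<rho>2 * (1 - 8 * s\<^sup>2 * C\<^sup>2)" by simp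
  have C1: "C \<le> 1" using C by (smt (verit) one_le_power power2_eq_square zero_less_power s(1))
  \<comment> \<open>\<open>s * w\<close> is the depth by which an outer disk enters the unit circle beyond its chord; the choice
     of \<open>u = 1 / w\<close> rationalises the square root relating \<open>r\<close> and \<open>\<rho>\<close>.\<close>
  define w1 u1 where "w1 = (r1 - \<rho>1 + C) / s" and "u1 = (r1 + \<rho>1 - C) / s"
  define w2 u2 where "w2 = (r2 - \<rho>2 + C) / s" and "u2 = (r2 + \<rho>2 - C) / s"
  have key: "u * w = 1 \<and> 0 < w \<and> w\<^sup>2 \<le> k * s * (w + s * (1 - w\<^sup>2) / 2) \<and> 0 < w * \<rho>
      \<and> w * \<rho> \<le> w + s * (1 - w\<^sup>2) / 2 \<and> r = s * (u + w) / 2 \<and> \<rho> - C = s * (u - w) / 2"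
    if w: "w = (r - \<rho> + C) / s" and u: "u = (r + \<rho> - C) / s" and "0 < r" "0 < \<rho>" "0 < k"
      and r: "r\<^sup>2 = \<rho>\<^sup>2 + 1 - 2 * \<rho> * C" "r \<le> (1 + k * s\<^sup>2) * \<rho> - C" for r \<rho> k u w :: real
  proof -
    have re: "r = s * (u + w) / 2" "\<rho> - C = s * (u - w) / 2"
      using s by (auto simp: u w field_simps)
    have "(\<rho> - C)\<^sup>2 < r\<^sup>2" using r C s by (simp add: power2_eq_square algebra_simps) (smt (verit) mult_pos_pos)
    then have "\<bar>\<rho> - C\<bar> < r" using \<open>0 < r\<close> by (metis abs_le_square_iff abs_of_pos linorder_not_le)
    then have w0: "0 < w" using s by (auto simp: w)
    \<comment> \<open>Intersecting chords: the midpoint of the chord cuts the diameter through it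
      into \<open>s * u\<close> and \<open>s * w\<close>.\<close>
    have "s\<^sup>2 * (u * w) = (r + (\<rho> - C)) * (r - (\<rho> - C))"
      using s by (simp add: u w power2_eq_square field_simps)
    also have "\<dots> = s\<^sup>2" using r C by (simp add: power2_eq_square algebra_simps)
    finally have uw: "u * w = 1" using s by simp
    have "s * w = r - \<rho> + C" using s by (simp add: w)
    then have "s * w \<le> s * (k * s * \<rho>)" using r(2) by (simp add: power2_eq_square algebra_simps)
    then have "w \<le> k * s * \<rho>" using s by simp
    then have "w * w \<le> w * (k * s * \<rho>)" using w0 by (intro mult_left_mono) auto
    then have 1: "w\<^sup>2 \<le> k * s * (w * \<rho>)" by (simp add: power2_eq_square algebra_simps)
    have "w * \<rho> = w * C + w * (\<rho> - C)" by (simp add: algebra_simps)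
    also have "w * (\<rho> - C) = s * (u * w - w\<^sup>2) / 2" unfolding re by (simp add: power2_eq_square algebra_simps)
    finally have "w * \<rho> = w * C + s * (1 - w\<^sup>2) / 2" by (simp add: uw)
    moreover have "w * C \<le> w" using w0 C1 by simp
    ultimately have 2: "w * \<rho> \<le> w + s * (1 - w\<^sup>2) / 2" by simp
    then have "k * s * (w * \<rho>) \<le> k * s * (w + s * (1 - w\<^sup>2) / 2)"
      using s \<open>0 < k\<close> by (intro mult_left_mono) auto
    then show ?thesis using 1 2 uw w0 re \<open>0 < \<rho>\<close> by auto
  qed
  note k1 = key[OF w1_def u1_def pos(1,3) zero_less_numeral r1] and k2 = key[OF w2_def u2_def pos(2,4) zero_less_numeral r2]
  have "2 * (r1 * r2) \<le> - 2 * s\<^sup>2 - 2 * ((\<rho>1 - C) * (\<rho>2 - C)) + 16 * s\<^sup>2 * C\<^sup>2 * (\<rho>1 * \<rho>2)"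
    using d r1(1) r2(1) C(2) by (simp add: power2_eq_square algebra_simps)
  moreover have "2 * (r1 * r2) + 2 * ((\<rho>1 - C) * (\<rho>2 - C)) = s\<^sup>2 * (u1 * u2 + w1 * w2)"
  proof -
    have "2 * (r1 * r2) + 2 * ((\<rho>1 - C) * (\<rho>2 - C)) =
       2 * (s * (u1 + w1) / 2 * (s * (u2 + w2) / 2)) + 2 * (s * (u1 - w1) / 2 * (s * (u2 - w2) / 2))"
      using k1 k2 by metis
    also have "\<dots> = s\<^sup>2 * (u1 * u2 + w1 * w2)" by (simp add: power2_eq_square field_simps)
    finally show ?thesis .
  qed
  ultimately have "s\<^sup>2 * (u1 * u2 + w1 * w2 + 2) \<le> s\<^sup>2 * (16 * C\<^sup>2 * (\<rho>1 * \<rho>2))"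
    by (simp add: algebra_simps)
  then have "u1 * u2 + w1 * w2 + 2 \<le> 16 * C\<^sup>2 * (\<rho>1 * \<rho>2)" using s by simp
  also have "\<dots> \<le> 16 * 1 * (\<rho>1 * \<rho>2)"
    using pos C s by (intro mult_right_mono) (auto simp: power2_eq_square intro!: mult_le_one C1)
  finally have "(w1 * w2) * (u1 * u2 + w1 * w2 + 2) \<le> (w1 * w2) * (16 * (\<rho>1 * \<rho>2))"
    using k1 k2 by (intro mult_left_mono) auto
  moreover have "(w1 * w2) * (u1 * u2 + w1 * w2 + 2) = (u1 * w1) * (u2 * w2) + (w1 * w2)\<^sup>2 + 2 * (w1 * w2)"
    by (simp add: power2_eq_square algebra_simps)
  ultimately have "(1 + w1 * w2)\<^sup>2 \<le> 16 * (w1 * \<rho>1) * (w2 * \<rho>2)"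
    using k1 k2 by (simp add: power2_eq_square algebra_simps)
  also have "\<dots> \<le> 16 * (w1 + s * (1 - w1\<^sup>2) / 2) * (w2 + s * (1 - w2\<^sup>2) / 2)"
    using k1 k2 by (intro mult_mono) auto
  finally show False using cap_widths_inequality[of s w1 w2] k1 k2 s by auto
qed

text \<open>The bound is attained when the inner disk \<open>b\<close> also touches the vertex \<open>cis (- \<theta>)\<close>; every other
  position of \<open>b\<close> leaves even less room for the outer disk.\<close>
lemma outer_disk_bound:
  fixes \<theta> \<psi> \<rho> q R :: real and b :: complex
  defines "C \<equiv> cos (\<theta> / 2)" and "s \<equiv> sin (\<theta> / 2)"
  assumes s: "0 < s" "0 < C" and \<psi>: "s \<le> sin \<psi>"
    and b: "norm b = R" "dist b 1 = R" "R \<le> dist b (cis (- \<theta>))"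
    and q: "0 < q" "q \<le> \<rho>" "q\<^sup>2 = \<rho>\<^sup>2 + 1 - 2 * \<rho> * C"
    and d: "R + q \<le> dist b (of_real \<rho> * cis \<psi>)"
  shows "q \<le> (1 + (cos \<theta> - cos (\<psi> + \<theta> / 2))) * \<rho> - C"
proof -
  \<comment> \<open>Being equidistant from 0 and 1, \<open>b\<close> has real part 1/2, and
    \<open>\<tau>\<close> is its only freedom. Emptiness at \<open>cis (- \<theta>)\<close> becomes
    \<open>\<tau>\<close> \<ge> - tan (\<open>\<theta> / 2\<close>), the later fact
    \<open>nonneg\<close>.\<close>
  define \<tau> where "\<tau> = 2 * Im b"
  have R0: "0 \<le> R" using b by auto
  have cs: "C\<^sup>2 + s\<^sup>2 = 1" by (simp add: C_def s_def)
  have \<theta>: "cos \<theta> = 1 - 2 * s\<^sup>2" "sin \<theta> = 2 * s * C" "1 + cos \<theta> = 2 * C\<^sup>2"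
    using cos_double_sin[of "\<theta>/2"] sin_double[of "\<theta>/2"] cos_double_cos[of "\<theta>/2"] by (simp_all add: C_def s_def)
  have n1: "(Re b)\<^sup>2 + (Im b)\<^sup>2 = R\<^sup>2" using b(1) by (metis cmod_power2)
  have "(dist b 1)\<^sup>2 = (Re b - 1)\<^sup>2 + (Im b)\<^sup>2" by (simp add: dist_norm cmod_power2)
  then have re: "Re b = 1 / 2" using b(2) n1 by (simp add: power2_eq_square algebra_simps)
  have R2: "(2 * R)\<^sup>2 = 1 + \<tau>\<^sup>2" using n1 re by (simp add: \<tau>_def power2_eq_square)
  have "R\<^sup>2 \<le> (dist b (cis (- \<theta>)))\<^sup>2" using b(3) R0 by (intro power_mono) auto
  also have "\<dots> = (1/2 - cos \<theta>)\<^sup>2 + (Im b + sin \<theta>)\<^sup>2" by (simp add: dist_norm cmod_power2 re)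
  also have "\<dots> = R\<^sup>2 + 1 - cos \<theta> + \<tau> * sin \<theta>"
    using n1 sin_cos_squared_add[of \<theta>] unfolding re \<tau>_def power2_eq_square by (simp only: algebra_simps)
  finally have "0 \<le> (2 * s) * (\<tau> * C + s)" by (simp add: \<theta> power2_eq_square algebra_simps)
  then have nonneg: "0 \<le> \<tau> * C + s" using s by (simp add: zero_le_mult_iff)
  define x y where "x = \<rho> * cos \<psi>" and "y = \<rho> * sin \<psi>"
  have "x\<^sup>2 + y\<^sup>2 = \<rho>\<^sup>2 * ((sin \<psi>)\<^sup>2 + (cos \<psi>)\<^sup>2)"
    unfolding x_def y_def power_mult_distrib by (simp only: algebra_simps)
  then have xy: "x\<^sup>2 + y\<^sup>2 = \<rho>\<^sup>2" by simp
  have "(R + q)\<^sup>2 \<le> (dist b (of_real \<rho> * cis \<psi>))\<^sup>2" using d R0 q by (intro power_mono) auto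
  also have "\<dots> = (1/2 - x)\<^sup>2 + (Im b - y)\<^sup>2" by (simp add: dist_norm cmod_power2 re x_def y_def)
  also have "\<dots> = R\<^sup>2 + \<rho>\<^sup>2 - (x + \<tau> * y)"
    using n1 xy unfolding re by (simp add: \<tau>_def power2_eq_square algebra_simps)
  finally have "2 * R * q \<le> 2 * \<rho> * C - 1 - (x + \<tau> * y)"
    using q(3) by (simp add: power2_eq_square algebra_simps)
  then have "2 * R * q \<le> 2 * \<rho> * C - 1 - \<rho> * (cos \<psi> + \<tau> * sin \<psi>)"
    by (simp add: x_def y_def algebra_simps)
  \<comment> \<open>A Cauchy-Schwarz bound for \<open>2 * R\<close>, the root of
    \<open>1 + \<tau>\<^sup>2\<close>. It is exact when \<open>\<tau> * C + s = 0\<close> and makes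
    the whole estimate affine in \<open>\<tau>\<close>.\<close>
  moreover have "C - \<tau> * s \<le> 2 * R"
  proof (rule power2_le_imp_le)
    have "(C - \<tau> * s)\<^sup>2 \<le> (C - \<tau> * s)\<^sup>2 + (\<tau> * C + s)\<^sup>2" by simp
    also have "\<dots> = (C\<^sup>2 + s\<^sup>2) * (1 + \<tau>\<^sup>2)" by (simp add: power2_eq_square algebra_simps)
    finally show "(C - \<tau> * s)\<^sup>2 \<le> (2 * R)\<^sup>2" unfolding cs R2 by simp
  qed (use R0 in auto)
  then have "(C - \<tau> * s) * q \<le> 2 * R * q" using q by (intro mult_right_mono) auto
  ultimately have "(C - \<tau> * s) * q \<le> 2 * \<rho> * C - 1 - \<rho> * (cos \<psi> + \<tau> * sin \<psi>)" by simp
  then have "C * ((C - \<tau> * s) * q) \<le> C * (2 * \<rho> * C - 1 - \<rho> * (cos \<psi> + \<tau> * sin \<psi>))"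
    using s by (intro mult_left_mono) auto
  moreover have "C * ((C - \<tau> * s) * q) = (C\<^sup>2 + s\<^sup>2) * q - (\<tau> * C + s) * (s * q)"
    by (simp add: power2_eq_square algebra_simps)
  moreover have "C * (2 * \<rho> * C - 1 - \<rho> * (cos \<psi> + \<tau> * sin \<psi>)) =
      \<rho> * (1 + cos \<theta>) - C - \<rho> * cos (\<psi> + \<theta> / 2) - (\<tau> * C + s) * (\<rho> * sin \<psi>)"
    unfolding \<theta>(3) by (simp add: cos_add C_def[symmetric] s_def[symmetric] power2_eq_square algebra_simps)
  \<comment> \<open>The deviation from the extremal position is \<open>\<tau> * C + s\<close> times
    \<open>s * q - \<rho> * sin \<psi>\<close>, which has the favourable sign.\<close>
  moreover have "(\<tau> * C + s) * (s * q) \<le> (\<tau> * C + s) * (\<rho> * sin \<psi>)"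
  proof (intro mult_left_mono[OF _ nonneg])
    have "s * q \<le> sin \<psi> * \<rho>" using \<psi> q s by (intro mult_mono) auto
    then show "s * q \<le> \<rho> * sin \<psi>" by (simp add: mult.commute)
  qed
  ultimately have "q \<le> \<rho> * (1 + cos \<theta>) - C - \<rho> * cos (\<psi> + \<theta> / 2)" unfolding cs by simp
  then show ?thesis by (simp add: algebra_simps)
qed

section \<open>Parity: all but one unit of slack is used up\<close>

text \<open>Among three elements of a window, two consecutive gaps, each 1 or N - 1, would add up to
  2, N or 2N - 2, none of which is again 1 or N - 1.\<close>

lemma card_adjacent_window_le_2:
  fixes S :: "int set" and N lo :: int
  assumes N: "4 \<le> N"
    and adj: "\<And>j k. j \<in> S \<Longrightarrow> k \<in> S \<Longrightarrow> j < k \<Longrightarrow> k < j + N \<Longrightarrow> k = j + 1 \<or> k = j + N - 1"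
  shows "card (S \<inter> {lo..<lo + N}) \<le> 2"
proof (rule ccontr)
  assume "\<not> ?thesis"
  then have "3 \<le> card (S \<inter> {lo..<lo + N})" by simp
  then obtain U where U: "U \<subseteq> S \<inter> {lo..<lo + N}" "card U = 3" "finite U"
    by (metis obtain_subset_with_card_n card.infinite zero_neq_numeral)
  define a where "a = Min U"
  define c where "c = Max U"
  have "U \<noteq> {}" using U by auto
  then have ac: "a \<in> U" "c \<in> U" using U by (auto simp: a_def c_def)
  have "card (U - {a, c}) \<noteq> 0" using U ac by (auto simp: card_Diff_subset card_insert_if split: if_splits)
  then have "U - {a, c} \<noteq> {}" by force
  then obtain b where b: "b \<in> U" "b \<noteq> a" "b \<noteq> c" by auto
  have "a \<le> b" "b \<le> c" using b U by (auto simp: a_def c_def)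
  then have "a < b" "b < c" using b by auto
  moreover have "a \<in> {lo..<lo + N}" "c \<in> {lo..<lo + N}" using ac U by auto
  then have "c < a + N" by auto
  moreover have "a \<in> S" "b \<in> S" "c \<in> S" using ac b U by auto
  ultimately show False using adj[of a b] adj[of b c] adj[of a c] N by force
qed

lemma unit_weight_unique:
  fixes f :: "'a \<Rightarrow> nat"
  assumes "finite X" "sum f X \<le> 1" "x \<in> X" "y \<in> X" "x \<noteq> y" "1 \<le> f x"
  shows "f y = 0"
proof -
  have "f x + f y = sum f {x, y}" using assms by simp
  also have "\<dots> \<le> sum f X" using assms by (intro sum_mono2) auto
  finally show ?thesis using assms by simp
qed

text \<open>Which vertices each disk touches, indexed by all integers instead of residues modulo
  \<open>N\<close>: steps from a vertex need no modular arithmetic, and counting is done in a window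
  of \<open>N\<close> consecutive indices with free start \<open>lo\<close>. The bound 13 leaves
  room for the stretch from \<open>m - 4\<close> to \<open>m + 5\<close> used below.\<close>

locale cyclic_touching =
  fixes G :: "'d set" and T :: "'d \<Rightarrow> int set" and N :: int
  assumes fin: "finite G" and N: "13 \<le> N" and few: "2 * int (card G) \<le> N + 1"
    and adj: "\<And>X j k. X \<in> G \<Longrightarrow> j \<in> T X \<Longrightarrow> k \<in> T X \<Longrightarrow> j < k \<Longrightarrow> k < j + N \<Longrightarrow> k = j + 1 \<or> k = j + N - 1"
    and cov: "\<And>k. \<exists>X\<in>G. k \<in> T X"
begin

definition mult :: "int \<Rightarrow> nat" where "mult k = card {X \<in> G. k \<in> T X}"

text \<open>Either kind of waste, a disk touching fewer than two vertices or a vertex touched more than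
  once, is counted; the total is \<open>2 * card G - N \<le> 1\<close>.\<close>
definition slack :: "int \<Rightarrow> 'd + int \<Rightarrow> nat" where
  "slack lo x = (case x of Inl X \<Rightarrow> 2 - card (T X \<inter> {lo..<lo + N}) | Inr k \<Rightarrow> mult k - 1)"

lemma sum_slack: "sum (slack lo) (G <+> {lo..<lo + N}) \<le> 1"
proof -
  let ?I = "{lo..<lo + N}"
  \<comment> \<open>\<open>c2\<close> and \<open>m1\<close> make the truncated subtractions in
    \<open>slack\<close> exact; the rest counts contacts by disk and by vertex.\<close>
  have c2: "card (T X \<inter> ?I) \<le> 2" if "X \<in> G" for X
    using card_adjacent_window_le_2[of N "T X" lo] adj[OF that] N by simp
  have m1: "1 \<le> mult k" for k
    using cov[of k] fin by (auto simp: mult_def Suc_le_eq card_gt_0_iff)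
  have "(\<Sum>X\<in>G. card (T X \<inter> ?I)) = (\<Sum>X\<in>G. \<Sum>k\<in>?I. if k \<in> T X then 1 else 0)"
    by (intro sum.cong) (auto simp: sum.If_cases Int_commute)
  also have "\<dots> = (\<Sum>k\<in>?I. \<Sum>X\<in>G. if k \<in> T X then 1 else 0)" by (rule sum.swap)
  also have "\<dots> = (\<Sum>k\<in>?I. mult k)"
    using fin by (intro sum.cong) (auto simp: sum.If_cases mult_def Int_def)
  finally have 1: "(\<Sum>X\<in>G. card (T X \<inter> ?I)) = (\<Sum>k\<in>?I. mult k)" .
  have 2: "(\<Sum>X\<in>G. 2 - card (T X \<inter> ?I)) + (\<Sum>X\<in>G. card (T X \<inter> ?I)) = 2 * card G"
    using c2 by (simp flip: sum.distrib)
  have "(\<Sum>k\<in>?I. mult k - 1) + (\<Sum>k\<in>?I. 1) = (\<Sum>k\<in>?I. mult k)"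
    unfolding sum.distrib[symmetric] using le_add_diff_inverse2[OF m1] by (intro sum.cong) auto
  then have 3: "(\<Sum>k\<in>?I. mult k - 1) + nat N = (\<Sum>k\<in>?I. mult k)" by simp
  have "sum (slack lo) (G <+> ?I) = (\<Sum>X\<in>G. 2 - card (T X \<inter> ?I)) + (\<Sum>k\<in>?I. mult k - 1)"
    using fin by (simp add: sum.Plus slack_def comp_def)
  then show ?thesis using 1 2 3 few N by linarith
qed

text \<open>Without a defect the pairing propagates like dominoes: the disk at \<open>m + 1\<close>
  cannot use \<open>m\<close>, taken by \<open>B\<close>, so it takes \<open>m + 2\<close>, and the
  disk at \<open>m + 3\<close> is then left with \<open>m + 4\<close>. Defects are located near
  \<open>m\<close> so that those of opposite sides can be told apart.\<close>

lemma right_pairs_or_defect: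
  assumes B: "B \<in> G" "m \<in> T B" "m + 1 \<notin> T B" and lo: "lo \<le> m" "m + 4 < lo + N"
  shows "(\<exists>X\<in>G. \<exists>Y\<in>G. {m + 1, m + 2} \<subseteq> T X \<and> {m + 3, m + 4} \<subseteq> T Y)
    \<or> (\<exists>X\<in>G. X \<noteq> B \<and> card (T X \<inter> {lo..<lo + N}) \<le> 1 \<and> T X \<inter> {m + 1..m + 4} \<noteq> {})
    \<or> (\<exists>k\<in>{m..m + 4}. 2 \<le> mult k)"
proof (rule ccontr)
  let ?I = "{lo..<lo + N}"
  assume neg: "\<not> ?thesis"
  \<comment> \<open>In effect \<open>k\<close> is \<open>m + 1\<close>, \<open>m + 2\<close> or
    \<open>m + 3\<close>. The window contains \<open>m\<close> and \<open>m + 4\<close>, so the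
    cyclic neighbours of \<open>k\<close> at distance \<open>N - 1\<close> fall outside it.\<close>
  have full: "\<exists>j\<in>T X. j = k - 1 \<or> j = k + 1"
    if X: "X \<in> G" "X \<noteq> B" "k \<in> T X" "k \<in> {m + 1..m + 4}" "k = m + 4 \<Longrightarrow> False" for X k
  proof -
    have "\<not> card (T X \<inter> ?I) \<le> 1" using neg X by blast
    moreover have "card (T X \<inter> ?I) \<le> 1" if "T X \<inter> ?I \<subseteq> {k}"
      using card_mono[OF _ that] by simp
    ultimately obtain j where j: "j \<in> T X" "j \<in> ?I" "j \<noteq> k" by blast
    show ?thesis using adj[OF X(1), of j k] adj[OF X(1), of k j] j X lo N by force
  qed
  have once: False if "X \<in> G" "Y \<in> G" "X \<noteq> Y" "k \<in> T X" "k \<in> T Y" "k \<in> {m..m + 4}" for X Y k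
  proof -
    have "card {X, Y} \<le> mult k" unfolding mult_def using that fin by (intro card_mono) auto
    then have "2 \<le> mult k" using that by simp
    then show False using neg that by blast
  qed
  obtain X where X: "X \<in> G" "m + 1 \<in> T X" using cov by blast
  then have "X \<noteq> B" using B by auto
  have "m \<notin> T X" using once[of X B m] X B \<open>X \<noteq> B\<close> by auto
  then have D2: "m + 2 \<in> T X" using full[of X "m + 1"] X \<open>X \<noteq> B\<close> by (auto simp: add.commute)
  obtain Y where Y: "Y \<in> G" "m + 3 \<in> T Y" using cov by blast
  have "Y \<noteq> B" using adj[OF B(1), of m "m + 3"] Y B N by auto
  have "Y \<noteq> X" using adj[OF X(1), of "m + 1" "m + 3"] Y X N by auto
  then have "m + 2 \<notin> T Y" using once[of X Y "m + 2"] X D2 Y by auto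
  then have "m + 4 \<in> T Y" using full[of Y "m + 3"] Y \<open>Y \<noteq> B\<close> by (auto simp: algebra_simps)
  then show False using neg X D2 Y by blast
qed

end

lemma (in cyclic_touching) reflect: "cyclic_touching G (\<lambda>X. uminus ` T X) N"
proof
  show "\<exists>X\<in>G. k \<in> uminus ` T X" for k using cov[of "- k"] by (force simp: image_iff)
  show "k = j + 1 \<or> k = j + N - 1"
    if "X \<in> G" "j \<in> uminus ` T X" "k \<in> uminus ` T X" "j < k" "k < j + N" for X j k
    using adj[OF that(1), of "- k" "- j"] that by (auto simp: image_iff)
qed (use fin N few in auto)

context cyclic_touching begin

lemma left_pairs_or_defect:
  assumes B: "B \<in> G" "m \<in> T B" "m - 1 \<notin> T B" and lo: "lo \<le> m - 4" "m < lo + N"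
  shows "(\<exists>X\<in>G. \<exists>Y\<in>G. {m - 1, m - 2} \<subseteq> T X \<and> {m - 3, m - 4} \<subseteq> T Y)
    \<or> (\<exists>X\<in>G. X \<noteq> B \<and> card (T X \<inter> {lo..<lo + N}) \<le> 1 \<and> T X \<inter> {m - 4..m - 1} \<noteq> {})
    \<or> (\<exists>k\<in>{m - 4..m}. 2 \<le> mult k)"
proof -
  interpret R: cyclic_touching G "\<lambda>X. uminus ` T X" N by (rule reflect)
  have mem: "x \<in> uminus ` T X \<longleftrightarrow> - x \<in> T X" for x X by (force simp: image_iff)
  \<comment> \<open>The reflected window starts at the negative of the old last index
    \<open>lo + N - 1\<close>.\<close>
  have "uminus ` {lo..<lo + N} = {1 - lo - N..<1 - lo - N + N}"
    by (force simp: image_iff Bex_def intro: exI[of _ "- x" for x])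
  then have "uminus ` T X \<inter> {1 - lo - N..<1 - lo - N + N} = uminus ` (T X \<inter> {lo..<lo + N})" for X
    by (simp add: image_Int)
  then have c: "card (uminus ` T X \<inter> {1 - lo - N..<1 - lo - N + N}) = card (T X \<inter> {lo..<lo + N})" for X
    by (simp add: card_image)
  have m: "R.mult k = mult (- k)" for k by (simp add: R.mult_def mult_def mem)
  have lo': "1 - lo - N \<le> - m" "- m + 4 < 1 - lo - N + N" using lo by auto
  have B': "- m \<in> uminus ` T B" "- m + 1 \<notin> uminus ` T B" using B(2,3) by (auto simp: mem)
  consider (pairs) "\<exists>X\<in>G. \<exists>Y\<in>G. {- m + 1, - m + 2} \<subseteq> uminus ` T X \<and> {- m + 3, - m + 4} \<subseteq> uminus ` T Y"
    | (single) X where "X \<in> G" "X \<noteq> B" "card (T X \<inter> {lo..<lo + N}) \<le> 1" "uminus ` T X \<inter> {- m + 1..- m + 4} \<noteq> {}"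
    | (double) k where "k \<in> {- m..- m + 4}" "2 \<le> mult (- k)"
    using R.right_pairs_or_defect[OF B(1) B'(1) B'(2) lo'] unfolding c m by blast
  then show ?thesis
  proof cases
    case pairs
    then show ?thesis by (simp add: mem)
  next
    case single
    then obtain x where "x \<in> T X" "- x \<in> {- m + 1..- m + 4}" by blast
    then have "x \<in> T X \<inter> {m - 4..m - 1}" by auto
    then show ?thesis using single by blast
  next
    case double
    then have "- k \<in> {m - 4..m}" by auto
    then show ?thesis using double by blast
  qed
qed

text \<open>If \<open>B\<close> touches two neighbours, failure on both sides would produce two
  different defects, exceeding the total slack of 1. If \<open>B\<close> touches one vertex of the
  window, \<open>B\<close> itself is the defect, and its right side must be clean.\<close>

lemma exists_adjacent_pairs:
  assumes B: "B \<in> G"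
  shows "\<exists>m\<in>T B. (\<exists>X\<in>G. \<exists>Y\<in>G. {m + 1, m + 2} \<subseteq> T X \<and> {m + 3, m + 4} \<subseteq> T Y)
    \<or> (\<exists>X\<in>G. \<exists>Y\<in>G. {m - 1, m - 2} \<subseteq> T X \<and> {m - 3, m - 4} \<subseteq> T Y)"
proof -
  have uniq: False if "x \<in> G <+> {lo..<lo + N}" "y \<in> G <+> {lo..<lo + N}" "x \<noteq> y"
    "1 \<le> slack lo x" "1 \<le> slack lo y" for x y lo
    using unit_weight_unique[OF _ sum_slack that(1-4)] fin that by simp
  \<comment> \<open>At most one contact of \<open>B\<close> is missing, so it touches some
    vertex.\<close>
  have "slack 0 (Inl B) \<le> 1"
    using member_le_sum[of "Inl B" "G <+> {0..<0 + N}" "slack 0"] sum_slack[of 0] fin B by fastforce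
  then have "T B \<inter> {0..<0 + N} \<noteq> {}" unfolding slack_def by (auto simp: card_eq_0_iff)
  then obtain k where k: "k \<in> T B" by blast
  show ?thesis
  proof (cases "\<exists>m. m \<in> T B \<and> m + 1 \<in> T B")
    case True
    then obtain m where m: "m \<in> T B" "m + 1 \<in> T B" by blast
    define lo where "lo = m - 6"
    have out: "m + 1 + 1 \<notin> T B" "m - 1 \<notin> T B"
      using adj[OF B, of m "m + 2"] adj[OF B, of "m - 1" "m + 1"] m N
      by (auto simp: algebra_simps)
    show ?thesis
    proof (rule ccontr)
      assume neg: "\<not> ?thesis"
      have eqs: "m + 1 + 1 = m + 2" "m + 1 + 2 = m + 3" "m + 1 + 3 = m + 4" "m + 1 + 4 = m + 5" by auto
      have single: "Inl X \<in> G <+> {lo..<lo + N}" "1 \<le> slack lo (Inl X)"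
        if "X \<in> G" "card (T X \<inter> {lo..<lo + N}) \<le> 1" for X using that by (auto simp: slack_def)
      have double: "Inr k \<in> G <+> {lo..<lo + N}" "1 \<le> slack lo (Inr k)"
        if "2 \<le> mult k" "k \<in> {m - 4..m + 5}" for k using that N by (auto simp: slack_def lo_def)
      have lo: "lo \<le> m + 1" "m + 1 + 4 < lo + N" "lo \<le> m - 4" "m < lo + N" using N by (auto simp: lo_def)
      have nR: "\<not> (\<exists>X\<in>G. \<exists>Y\<in>G. {i + 1, i + 2} \<subseteq> T X \<and> {i + 3, i + 4} \<subseteq> T Y)"
        and nL: "\<not> (\<exists>X\<in>G. \<exists>Y\<in>G. {i - 1, i - 2} \<subseteq> T X \<and> {i - 3, i - 4} \<subseteq> T Y)"
        if "i \<in> T B" for i using neg that by blast+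
      have R: "(\<exists>X\<in>G. X \<noteq> B \<and> card (T X \<inter> {lo..<lo + N}) \<le> 1 \<and> T X \<inter> {m + 2..m + 5} \<noteq> {})
          \<or> (\<exists>k\<in>{m + 1..m + 5}. 2 \<le> mult k)"
        using right_pairs_or_defect[OF B m(2) out(1) lo(1,2), unfolded eqs] nR[OF m(2), unfolded eqs] by argo
      have L: "(\<exists>X\<in>G. X \<noteq> B \<and> card (T X \<inter> {lo..<lo + N}) \<le> 1 \<and> T X \<inter> {m - 4..m - 1} \<noteq> {})
          \<or> (\<exists>k\<in>{m - 4..m}. 2 \<le> mult k)"
        using left_pairs_or_defect[OF B m(1) out(2) lo(3,4)] nL[OF m(1)] by argo
      \<comment> \<open>One underfull disk cannot be the defect of both sides: its contacts would be
        3 to 9 steps apart, hence not neighbours.\<close>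
      have no1: False if "X \<in> G" "T X \<inter> {m + 2..m + 5} \<noteq> {}" "T X \<inter> {m - 4..m - 1} \<noteq> {}" for X
      proof -
        note h = that
        obtain i where "i \<in> T X \<inter> {m + 2..m + 5}" using h(2) by blast
        moreover obtain j where "j \<in> T X \<inter> {m - 4..m - 1}" using h(3) by blast
        ultimately show False using adj[OF that(1), of j i] N by auto
      qed
      from R show False
      proof
        assume "\<exists>X\<in>G. X \<noteq> B \<and> card (T X \<inter> {lo..<lo + N}) \<le> 1 \<and> T X \<inter> {m + 2..m + 5} \<noteq> {}"
        then obtain X where X: "X \<in> G" "card (T X \<inter> {lo..<lo + N}) \<le> 1" "T X \<inter> {m + 2..m + 5} \<noteq> {}" by blast
        from L show False
        proof
          assume "\<exists>X\<in>G. X \<noteq> B \<and> card (T X \<inter> {lo..<lo + N}) \<le> 1 \<and> T X \<inter> {m - 4..m - 1} \<noteq> {}"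
          then obtain Y where Y: "Y \<in> G" "card (T Y \<inter> {lo..<lo + N}) \<le> 1" "T Y \<inter> {m - 4..m - 1} \<noteq> {}" by blast
          then have "X \<noteq> Y" using X no1 by blast
          then show False using uniq[OF single(1)[OF X(1,2)] single(1)[OF Y(1,2)]] single(2)[OF X(1,2)] single(2)[OF Y(1,2)] by simp
        next
          assume "\<exists>k\<in>{m - 4..m}. 2 \<le> mult k"
          then obtain k where "2 \<le> mult k" "k \<in> {m - 4..m + 5}" by auto
          then show False using uniq[OF single(1)[OF X(1,2)] double(1)] single(2)[OF X(1,2)] double(2) by simp
        qed
      next
        assume "\<exists>k\<in>{m + 1..m + 5}. 2 \<le> mult k"
        then obtain k where k: "2 \<le> mult k" "k \<in> {m + 1..m + 5}" "k \<in> {m - 4..m + 5}" by auto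
        from L show False
        proof
          assume "\<exists>X\<in>G. X \<noteq> B \<and> card (T X \<inter> {lo..<lo + N}) \<le> 1 \<and> T X \<inter> {m - 4..m - 1} \<noteq> {}"
          then obtain Y where Y: "Y \<in> G" "card (T Y \<inter> {lo..<lo + N}) \<le> 1" by blast
          then show False using uniq[OF single(1)[OF Y] double(1)[OF k(1,3)]] single(2)[OF Y] double(2)[OF k(1,3)] by simp
        next
          assume "\<exists>k\<in>{m - 4..m}. 2 \<le> mult k"
          then obtain l where l: "2 \<le> mult l" "l \<in> {m - 4..m + 5}" "l \<noteq> k" using k by auto
          then show False using uniq[OF double(1)[OF k(1,3)] double(1)[OF l(1,2)]] double(2)[OF k(1,3)] double(2)[OF l(1,2)] by simp
        qed
      qed
    qed
  next
    case False
    define lo where "lo = k - 6"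
    have out: "k + 1 \<notin> T B" "k - 1 \<notin> T B" using False k by (auto dest: spec[of _ "k - 1"])
    have "T B \<inter> {lo..<lo + N} \<subseteq> {k}"
      using adj[OF B, of k] adj[OF B, of _ k] out k N by (force simp: lo_def)
    then have "card (T B \<inter> {lo..<lo + N}) \<le> 1" by (metis card_mono finite.emptyI finite.insertI is_singletonI is_singleton_altdef)
    then have sB: "1 \<le> slack lo (Inl B)" by (simp add: slack_def)
    show ?thesis
    proof (rule ccontr)
      assume neg: "\<not> ?thesis"
      have lo: "lo \<le> k" "k + 4 < lo + N" using N by (auto simp: lo_def)
      consider X where "X \<in> G" "X \<noteq> B" "card (T X \<inter> {lo..<lo + N}) \<le> 1" | l where "l \<in> {k..k + 4}" "2 \<le> mult l"
        using right_pairs_or_defect[OF B k out(1) lo] neg k by blast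
      then have "\<exists>x\<in>G <+> {lo..<lo + N}. 1 \<le> slack lo x \<and> x \<noteq> Inl B"
      proof cases
        case 1
        then show ?thesis by (intro bexI[of _ "Inl X"]) (auto simp: slack_def)
      next
        case 2
        then show ?thesis using N by (intro bexI[of _ "Inr l"]) (auto simp: slack_def lo_def)
      qed
      then show False using uniq[of _ lo "Inl B"] sB B by blast
    qed
  qed
qed

end

section \<open>The regular polygon with its centre\<close>

lemma dist_polar_sq:
  "(dist (of_real \<rho> * cis \<alpha>) (of_real \<sigma> * cis \<beta>))\<^sup>2 = \<rho>\<^sup>2 + \<sigma>\<^sup>2 - 2 * \<rho> * \<sigma> * cos (\<beta> - \<alpha>)"
proof -
  show ?thesis
    unfolding dist_norm cmod_power2 cos_diff
    by (simp add: power2_diff power_mult_distrib sin_squared_eq algebra_simps)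
qed

text \<open>Normalised position: the inner disk touches vertex 0, the outer ones belong to the pairs
  1, 2 and 3, 4, whose bisectors have the angles \<open>3 * \<theta> / 2\<close> and
  \<open>7 * \<theta> / 2\<close>. Emptiness at vertex -1 keeps the inner disk from tilting away
  from the pairs.\<close>

lemma adjacent_pairs_conflict:
  fixes \<theta> :: real
  assumes \<theta>: "0 < \<theta>" "\<theta> \<le> 2 * pi / 173"
    and b: "norm b = R" "dist b 1 = R" "R \<le> dist b (cis (- \<theta>))"
    and c1: "c1 = of_real \<rho>1 * cis (3 * \<theta> / 2)" "0 < q1" "q1 \<le> \<rho>1" "dist c1 (cis \<theta>) = q1" "R + q1 \<le> dist b c1"
    and c2: "c2 = of_real \<rho>2 * cis (7 * \<theta> / 2)" "0 < q2" "q2 \<le> \<rho>2" "dist c2 (cis (3 * \<theta>)) = q2" "R + q2 \<le> dist b c2"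
    and disj: "q1 + q2 \<le> dist c1 c2"
  shows False
proof -
  define s C where "s = sin (\<theta> / 2)" and "C = cos (\<theta> / 2)"
  have pi: "pi \<le> 3.1416" "3 < pi" using pi_approx by simp_all
  have \<theta>': "\<theta> / 2 \<le> 0.01816" using \<theta> pi by simp
  have s: "0 < s" "s \<le> 1816/100000" unfolding s_def
    using \<theta> \<theta>' pi sin_x_le_x[of "\<theta>/2"] by (auto intro!: sin_gt_zero)
  have C: "0 < C" "C\<^sup>2 + s\<^sup>2 = 1" using \<theta> \<theta>' pi by (auto simp: C_def s_def intro!: cos_gt_zero)
  have k: "cos \<theta> = 1 - 2 * s\<^sup>2" "sin \<theta> = 2 * s * C"
    using cos_double_sin[of "\<theta>/2"] sin_double[of "\<theta>/2"] by (simp_all add: C_def s_def)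
  have cos2: "cos (2 * \<theta>) = 1 - 8 * s\<^sup>2 * C\<^sup>2"
    using cos_double_sin[of \<theta>] k by (simp add: power_mult_distrib)
  have sin_mono: "s \<le> sin (x * \<theta> / 2)" if "1 \<le> x" "x \<le> 7" for x
  proof -
    have "\<theta> / 2 \<le> x * \<theta> / 2" using that \<theta> by simp
    moreover have "x * \<theta> \<le> 7 * \<theta>" using that \<theta> by (intro mult_right_mono) auto
    then have "x * \<theta> / 2 \<le> pi / 2" using \<theta> pi by linarith
    ultimately show ?thesis unfolding s_def using \<theta> \<theta>' pi by (intro sin_monotone_2pi_le) auto
  qed
  have q1: "q1\<^sup>2 = \<rho>1\<^sup>2 + 1 - 2 * \<rho>1 * C" and q2: "q2\<^sup>2 = \<rho>2\<^sup>2 + 1 - 2 * \<rho>2 * C"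
    using dist_polar_sq[of \<rho>1 "3 * \<theta> / 2" 1 \<theta>] dist_polar_sq[of \<rho>2 "7 * \<theta> / 2" 1 "3 * \<theta>"] c1 c2
    by (simp_all add: C_def)
  have sums: "3 * \<theta> / 2 + \<theta> / 2 = 2 * \<theta>" "7 * \<theta> / 2 + \<theta> / 2 = 2 * (2 * \<theta>)" by simp_all
  have "C\<^sup>2 \<le> 1" using C by (smt (verit) zero_le_power2)
  have a1: "cos \<theta> - cos (2 * \<theta>) \<le> 6 * s\<^sup>2"
  proof -
    have "8 * s\<^sup>2 * C\<^sup>2 \<le> 8 * s\<^sup>2 * 1" using \<open>C\<^sup>2 \<le> 1\<close> by (intro mult_left_mono) auto
    then show ?thesis unfolding cos2 k by simp
  qed
  have a2: "cos \<theta> - cos (2 * (2 * \<theta>)) \<le> 30 * s\<^sup>2"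
  proof -
    define c where "c = cos \<theta>"
    have c: "c \<le> 1" "0 \<le> c" using \<theta> \<theta>' pi by (auto simp: c_def intro!: cos_ge_zero)
    have "c * c \<le> 1 * 1" using c by (intro mult_mono) auto
    moreover have "c * c * c \<le> 1 * 1" using c calculation by (intro mult_mono) auto
    \<comment> \<open>This product is \<open>15 * (1 - c)\<close> minus the left side of the claim,
      as a polynomial in \<open>c\<close>.\<close>
    ultimately have "0 \<le> (1 - c) * (16 - 8 * (c * c) - 8 * (c * c * c))" using c by (intro mult_nonneg_nonneg) auto
    moreover have "cos (2 * (2 * \<theta>)) = 2 * (2 * c\<^sup>2 - 1)\<^sup>2 - 1" unfolding cos_double_cos c_def ..
    moreover have "30 * s\<^sup>2 = 15 * (1 - c)" unfolding c_def k by simp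
    ultimately show ?thesis unfolding c_def[symmetric] by (simp add: power2_eq_square algebra_simps)
  qed
  have "q1 \<le> (1 + (cos \<theta> - cos (2 * \<theta>))) * \<rho>1 - C"
    using outer_disk_bound[of \<theta> "3 * \<theta> / 2" b R q1 \<rho>1] s C b c1 q1 sin_mono[of 3] sums by (simp add: s_def C_def)
  also have "\<dots> \<le> (1 + 6 * s\<^sup>2) * \<rho>1 - C" using a1 c1 by (intro diff_right_mono mult_right_mono add_left_mono) auto
  finally have b1: "q1 \<le> (1 + 6 * s\<^sup>2) * \<rho>1 - C" .
  have "q2 \<le> (1 + (cos \<theta> - cos (2 * (2 * \<theta>)))) * \<rho>2 - C"
    using outer_disk_bound[of \<theta> "7 * \<theta> / 2" b R q2 \<rho>2] s C b c2 q2 sin_mono[of 7] sums by (simp add: s_def C_def)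
  also have "\<dots> \<le> (1 + 30 * s\<^sup>2) * \<rho>2 - C" using a2 c2 by (intro diff_right_mono mult_right_mono add_left_mono) auto
  finally have b2: "q2 \<le> (1 + 30 * s\<^sup>2) * \<rho>2 - C" .
  have "(q1 + q2)\<^sup>2 \<le> (dist c1 c2)\<^sup>2" using disj c1 c2 by (intro power_mono) auto
  also have "\<dots> = \<rho>1\<^sup>2 + \<rho>2\<^sup>2 - 2 * \<rho>1 * \<rho>2 * cos (7 * \<theta> / 2 - 3 * \<theta> / 2)"
    unfolding c1(1) c2(1) by (rule dist_polar_sq)
  also have "7 * \<theta> / 2 - 3 * \<theta> / 2 = 2 * \<theta>" by simp
  finally show False using outer_disks_overlap[OF s C c1(2) c2(2) _ _ q1 b1 q2 b2] c1 c2 unfolding cos2 by linarith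
qed


text \<open>The centre lies on the bisector of the two vertices at a signed distance
  \<open>p\<close> from the origin. For \<open>p > 0\<close> any vertex on the arc from
  \<open>j\<close> to \<open>k\<close> would be nearer than these two, for \<open>p < 0\<close> any
  vertex on the complementary arc; \<open>p = 0\<close> would put the origin inside the
  disk.\<close>

lemma touching_neighbours:
  fixes N j k :: int and c :: complex and r \<theta> :: real
  assumes N: "4 \<le> N" and \<theta>: "\<theta> = 2 * pi / of_int N" and r: "0 < r" "r \<le> norm c"
    and out: "\<And>l::int. r \<le> dist c (cis (of_int l * \<theta>))"
    and touch: "dist c (cis (of_int j * \<theta>)) = r" "dist c (cis (of_int k * \<theta>)) = r"
    and jk: "j < k" "k < j + N"
  shows "k = j + 1 \<or> k = j + N - 1"
    and "k = j + 1 \<Longrightarrow> c = of_real (norm c) * cis ((of_int j + 1 / 2) * \<theta>)"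
proof -
  define \<mu> \<delta> where "\<mu> = (of_int j + of_int k) * \<theta> / 2" and "\<delta> = (of_int k - of_int j) * \<theta> / 2"
  define p q where "p = Re (c * cis (- \<mu>))" and "q = Im (c * cis (- \<mu>))"
  have \<theta>0: "0 < \<theta>" using N by (simp add: \<theta>)
  have N\<theta>: "of_int N * \<theta> = 2 * pi" using N by (simp add: \<theta>)
  have "of_int (k - j) * \<theta> < of_int N * \<theta>" using \<theta>0 jk by (intro mult_strict_right_mono) auto
  then have \<delta>: "0 < \<delta>" "\<delta> < pi" using N\<theta> jk \<theta>0 by (auto simp: \<delta>_def)
  have D: "(dist c (cis (\<mu> + t)))\<^sup>2 = p\<^sup>2 + q\<^sup>2 + 1 - 2 * (p * cos t + q * sin t)" for t
  proof -
    have "dist c (cis (\<mu> + t)) = norm ((c - cis (\<mu> + t)) * cis (- \<mu>))" by (simp add: norm_mult dist_norm)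
    also have "(c - cis (\<mu> + t)) * cis (- \<mu>) = c * cis (- \<mu>) - cis t" by (simp add: left_diff_distrib cis_mult)
    finally have "(dist c (cis (\<mu> + t)))\<^sup>2 = (p - cos t)\<^sup>2 + (q - sin t)\<^sup>2"
      unfolding p_def q_def by (simp add: cmod_power2)
    then show ?thesis by (simp add: power2_diff sin_squared_eq)
  qed
  have ang: "of_int j * \<theta> = \<mu> + - \<delta>" "of_int k * \<theta> = \<mu> + \<delta>" "of_int (j + 1) * \<theta> = \<mu> + (\<theta> - \<delta>)"
    "of_int (k + 1) * \<theta> = \<mu> + (\<theta> + \<delta>)" by (simp_all add: \<mu>_def \<delta>_def field_simps)
  have tj: "r\<^sup>2 = p\<^sup>2 + q\<^sup>2 + 1 - 2 * (p * cos \<delta> - q * sin \<delta>)"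
    using D[of "- \<delta>"] touch(1) unfolding ang by simp
  have tk: "r\<^sup>2 = p\<^sup>2 + q\<^sup>2 + 1 - 2 * (p * cos \<delta> + q * sin \<delta>)"
    using D[of "\<delta>"] touch(2) unfolding ang by simp
  have "sin \<delta> > 0" using \<delta> by (rule sin_gt_zero)
  then have q0: "q = 0" using tj tk by simp
  have ge: "r\<^sup>2 \<le> (dist c (cis (of_int l * \<theta>)))\<^sup>2" for l :: int
    using out[of l] r by (intro power_mono) auto
  have "c = of_real p * cis \<mu>"
  proof -
    have "c * cis (- \<mu>) = of_real p" using q0 by (simp add: complex_eq_iff p_def q_def)
    then have "c * cis (- \<mu>) * cis \<mu> = of_real p * cis \<mu>" by simp
    then show ?thesis by (simp add: mult.assoc cis_mult)
  qed
  then have p0: "p \<noteq> 0" using r by auto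
  \<comment> \<open>It suffices to test \<open>j + 1\<close> and \<open>k + 1\<close>, the first
    vertices on the two arcs.\<close>
  have le: "p * cos (\<theta> - \<delta>) \<le> p * cos \<delta>" "p * cos (\<theta> + \<delta>) \<le> p * cos \<delta>"
    using ge[of "j + 1"] ge[of "k + 1"] tj unfolding ang D by (simp_all add: q0)
  have pneg: "p < 0" if "k \<noteq> j + 1"
  proof -
    have "2 * \<theta> \<le> of_int (k - j) * \<theta>" using that jk \<theta>0 by (intro mult_right_mono) auto
    then have "cos \<delta> < cos (\<delta> - \<theta>)" using \<delta> \<theta>0 by (intro cos_monotone_0_pi) (auto simp: \<delta>_def)
    moreover have "cos (\<delta> - \<theta>) = cos (\<theta> - \<delta>)" by (metis cos_minus minus_diff_eq)
    ultimately show ?thesis using le(1) p0 by (metis mult_less_cancel_left_pos linorder_neqE not_less)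
  qed
  have ppos: "0 < p" if "k \<noteq> j + N - 1"
  proof -
    have "of_int (k - j + 2) * \<theta> \<le> of_int N * \<theta>" using that jk \<theta>0 by (intro mult_right_mono) (auto simp del: of_int_add of_int_diff)
    then have "\<theta> + \<delta> \<le> pi" unfolding N\<theta> by (simp add: \<delta>_def field_simps)
    then have "cos (\<theta> + \<delta>) < cos \<delta>" using \<delta> \<theta>0 by (intro cos_monotone_0_pi) auto
    then show ?thesis using le(2) p0 by (metis mult_less_cancel_left_neg linorder_neqE not_less)
  qed
  show "k = j + 1 \<or> k = j + N - 1" using pneg ppos by fastforce
  show "c = of_real (norm c) * cis ((of_int j + 1 / 2) * \<theta>)" if "k = j + 1"
  proof -
    have "0 < p" using ppos that N by simp
    then have "norm c = p" using \<open>c = of_real p * cis \<mu>\<close> by (simp add: norm_mult)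
    moreover have "\<mu> = (of_int j + 1 / 2) * \<theta>" by (simp add: that \<mu>_def field_simps)
    ultimately show ?thesis using \<open>c = of_real p * cis \<mu>\<close> by simp
  qed
qed

lemma dist_mult_cis [simp]: "dist (a * cis t) (b * cis t) = dist a b"
  by (simp add: dist_norm norm_mult flip: left_diff_distrib)

lemma dist_cnj: "dist (cnj a) (cnj b) = dist a b"
  by (simp add: dist_norm flip: complex_cnj_diff)

lemma centred_polygon_disks:
  fixes G :: "(complex \<times> real) set" and N :: int and \<theta> :: real
  assumes N173: "173 \<le> N" and \<theta>: "\<theta> = 2 * pi / of_int N" and fin: "finite G"
    and pos: "\<And>X. X \<in> G \<Longrightarrow> 0 < snd X"
    and centre: "\<And>X. X \<in> G \<Longrightarrow> snd X \<le> norm (fst X)"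
    and out: "\<And>X k::int. X \<in> G \<Longrightarrow> snd X \<le> dist (fst X) (cis (of_int k * \<theta>))"
    and disj: "\<And>X Y. X \<in> G \<Longrightarrow> Y \<in> G \<Longrightarrow> X \<noteq> Y \<Longrightarrow> snd X + snd Y \<le> dist (fst X) (fst Y)"
    and cov: "\<And>k::int. \<exists>X\<in>G. dist (fst X) (cis (of_int k * \<theta>)) = snd X"
    and B: "B \<in> G" "norm (fst B) = snd B"
  shows "N + 1 < 2 * int (card G)"
proof (rule ccontr)
  assume few: "\<not> ?thesis"
  define T where "T X = {k::int. dist (fst X) (cis (of_int k * \<theta>)) = snd X}" for X
  have nbr: "k = j + 1 \<or> k = j + N - 1" "k = j + 1 \<Longrightarrow> fst X = of_real (norm (fst X)) * cis ((of_int j + 1 / 2) * \<theta>)"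
    if "X \<in> G" "j \<in> T X" "k \<in> T X" "j < k" "k < j + N" for X j k
    using touching_neighbours[OF _ \<theta> pos[OF that(1)] centre[OF that(1)] out[OF that(1)], of j k] that N173
    by (auto simp: T_def)
  interpret cyclic_touching G T N
    using few fin N173 nbr(1) cov by unfold_locales (auto simp: T_def)
  have "\<theta> \<le> 2 * pi / 173" unfolding \<theta> using N173 by (intro divide_left_mono) auto
  moreover have "0 < \<theta>" using N by (simp add: \<theta>)
  ultimately have \<theta>01: "0 < \<theta>" "\<theta> \<le> 2 * pi / 173" by auto
  \<comment> \<open>\<open>f\<close> is an isometry that moves vertex \<open>m\<close> to 1 and, for
    \<open>\<sigma> = - 1\<close>, also reverses orientation, so one argument serves both sides of
    \<open>B\<close>.\<close>
  have conflict: False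
    if X: "X \<in> G" "m + \<sigma> \<in> T X" "fst X = of_real (norm (fst X)) * cis (of_int m * \<theta> + of_int \<sigma> * (3 * \<theta> / 2))"
      and Y: "Y \<in> G" "m + 3 * \<sigma> \<in> T Y" "fst Y = of_real (norm (fst Y)) * cis (of_int m * \<theta> + of_int \<sigma> * (7 * \<theta> / 2))"
      and m: "m \<in> T B" and ne: "X \<noteq> Y" "B \<noteq> X" "B \<noteq> Y"
      and f: "\<And>a b. dist (f a) (f b) = dist a b" "f 0 = 0"
        "\<And>\<rho> x. f (of_real \<rho> * cis (of_int m * \<theta> + of_int \<sigma> * x)) = of_real \<rho> * cis x"
      and \<sigma>: "\<sigma> * \<sigma> = 1" for X Y m \<sigma> and f :: "complex \<Rightarrow> complex"
  proof -
    have fc: "f (cis (of_int l * \<theta>)) = cis (of_int (\<sigma> * (l - m)) * \<theta>)" for l :: int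
    proof -
      have "of_int \<sigma> * of_int \<sigma> = (1::real)" using \<sigma> by (metis of_int_1 of_int_mult)
      moreover have "of_int m * \<theta> + of_int \<sigma> * (of_int (\<sigma> * (l - m)) * \<theta>)
          = of_int m * \<theta> + of_int \<sigma> * of_int \<sigma> * ((of_int l - of_int m) * \<theta>)"
        by (simp add: algebra_simps)
      ultimately have "of_int m * \<theta> + of_int \<sigma> * (of_int (\<sigma> * (l - m)) * \<theta>) = of_int l * \<theta>"
        by (simp add: algebra_simps)
      then show ?thesis using f(3)[of 1 "of_int (\<sigma> * (l - m)) * \<theta>"] by simp
    qed
    have fd: "dist (f z) (cis (of_int (\<sigma> * (l - m)) * \<theta>)) = dist z (cis (of_int l * \<theta>))" for z l
      using f(1)[of z "cis (of_int l * \<theta>)"] by (simp only: fc)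
    have fn: "norm (f z) = norm z" for z using f(1)[of z 0] f(2) by (simp add: dist_norm)
    show False
    proof (rule adjacent_pairs_conflict[OF \<theta>01])
      show "norm (f (fst B)) = snd B" using B fn by simp
      show "dist (f (fst B)) 1 = snd B" using fd[of "fst B" m] m by (simp add: T_def)
      show "snd B \<le> dist (f (fst B)) (cis (- \<theta>))"
        using fd[of "fst B" "m - \<sigma>"] out[OF B(1), of "m - \<sigma>"] by (simp add: \<sigma>)
      show "f (fst X) = of_real (norm (fst X)) * cis (3 * \<theta> / 2)" using f(3) X(3) by metis
      show "f (fst Y) = of_real (norm (fst Y)) * cis (7 * \<theta> / 2)" using f(3) Y(3) by metis
      show "dist (f (fst X)) (cis \<theta>) = snd X" using fd[of "fst X" "m + \<sigma>"] X(2) by (simp add: T_def \<sigma>)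
      have "\<sigma> * (m + 3 * \<sigma> - m) = 3" using \<sigma> by simp
      from fd[of "fst Y" "m + 3 * \<sigma>", unfolded this]
      show "dist (f (fst Y)) (cis (3 * \<theta>)) = snd Y"
        using Y(2) by (simp add: T_def)
    qed (use pos centre disj X Y B ne f(1) in auto)
  qed
  from exists_adjacent_pairs[OF B(1)] obtain m where m: "m \<in> T B"
    and cases: "(\<exists>X\<in>G. \<exists>Y\<in>G. {m + 1, m + 2} \<subseteq> T X \<and> {m + 3, m + 4} \<subseteq> T Y)
      \<or> (\<exists>X\<in>G. \<exists>Y\<in>G. {m - 1, m - 2} \<subseteq> T X \<and> {m - 3, m - 4} \<subseteq> T Y)" by blast
  from cases show False
  proof
    assume "\<exists>X\<in>G. \<exists>Y\<in>G. {m + 1, m + 2} \<subseteq> T X \<and> {m + 3, m + 4} \<subseteq> T Y"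
    then obtain X Y where X: "X \<in> G" "m + 1 \<in> T X" "m + 2 \<in> T X" and Y: "Y \<in> G" "m + 3 \<in> T Y" "m + 4 \<in> T Y" by auto
    have ne: "B \<noteq> X" "B \<noteq> Y" "X \<noteq> Y"
      using nbr(1)[of B m "m + 2"] nbr(1)[of B m "m + 3"] nbr(1)[of X "m + 1" "m + 3"] X Y B m N by auto
    show False
    proof (rule conflict[of X m 1 Y "\<lambda>z. z * cis (- (of_int m * \<theta>))"])
      have "(of_int (m + 1) + 1 / 2) * \<theta> = of_int m * \<theta> + of_int 1 * (3 * \<theta> / 2)"
        "(of_int (m + 3) + 1 / 2) * \<theta> = of_int m * \<theta> + of_int 1 * (7 * \<theta> / 2)" by (simp_all add: field_simps)
      note angles = this
      show "fst X = of_real (norm (fst X)) * cis (of_int m * \<theta> + of_int 1 * (3 * \<theta> / 2))"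
        by (rule nbr(2)[OF X, unfolded angles]) (use N in auto)
      show "fst Y = of_real (norm (fst Y)) * cis (of_int m * \<theta> + of_int 1 * (7 * \<theta> / 2))"
        by (rule nbr(2)[OF Y, unfolded angles]) (use N in auto)
    qed (use X Y m ne in \<open>simp_all add: mult.assoc cis_mult\<close>)
  next
    assume "\<exists>X\<in>G. \<exists>Y\<in>G. {m - 1, m - 2} \<subseteq> T X \<and> {m - 3, m - 4} \<subseteq> T Y"
    then obtain X Y where X: "X \<in> G" "m - 2 \<in> T X" "m - 1 \<in> T X" and Y: "Y \<in> G" "m - 4 \<in> T Y" "m - 3 \<in> T Y" by auto
    have ne: "B \<noteq> X" "B \<noteq> Y" "X \<noteq> Y"
      using nbr(1)[of B "m - 2" m] nbr(1)[of B "m - 3" m] nbr(1)[of X "m - 3" "m - 1"] X Y B m N by auto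
    show False
    proof (rule conflict[of X m "- 1" Y "\<lambda>z. cnj (z * cis (- (of_int m * \<theta>)))"])
      have "(of_int (m - 2) + 1 / 2) * \<theta> = of_int m * \<theta> + of_int (- 1) * (3 * \<theta> / 2)"
        "(of_int (m - 4) + 1 / 2) * \<theta> = of_int m * \<theta> + of_int (- 1) * (7 * \<theta> / 2)" by (simp_all add: field_simps)
      note angles = this
      show "fst X = of_real (norm (fst X)) * cis (of_int m * \<theta> + of_int (- 1) * (3 * \<theta> / 2))"
        by (rule nbr(2)[OF X, unfolded angles]) (use N in auto)
      show "fst Y = of_real (norm (fst Y)) * cis (of_int m * \<theta> + of_int (- 1) * (7 * \<theta> / 2))"
        by (rule nbr(2)[OF Y, unfolded angles]) (use N in auto)
    qed (use X Y m ne in \<open>simp_all add: mult.assoc cis_mult cis_cnj dist_cnj\<close>)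
  qed
qed

text \<open>Otherwise the point dividing the segment of centres in the ratio \<open>r\<close> to
  \<open>q\<close> would be interior to both balls.\<close>

lemma dist_ge_of_disjoint_balls:
  fixes a b :: "'a::real_normed_vector"
  assumes "0 < r" "0 < q" "ball a r \<inter> ball b q = {}"
  shows "r + q \<le> dist a b"
proof (rule ccontr)
  assume lt: "\<not> ?thesis"
  define x where "x = a + (r / (r + q)) *\<^sub>R (b - a)"
  have "b - x = (q / (r + q)) *\<^sub>R (b - a)"
  proof -
    have "b - x = (1 - r / (r + q)) *\<^sub>R (b - a)" by (simp add: x_def algebra_simps)
    also have "1 - r / (r + q) = q / (r + q)" using assms by (simp add: field_simps)
    finally show ?thesis .
  qed
  then have "dist b x = q / (r + q) * dist a b" "dist a x = r / (r + q) * dist a b"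
    using assms by (simp_all add: dist_norm x_def norm_minus_commute)
  moreover have "t / (r + q) * dist a b < t" if "0 < t" for t
  proof -
    have "t / (r + q) * dist a b < t / (r + q) * (r + q)"
      using assms lt that by (intro mult_strict_left_mono) auto
    then show ?thesis using assms by simp
  qed
  note this[OF assms(1)] this[OF assms(2)]
  ultimately have "x \<in> ball a r \<inter> ball b q" by simp
  then show False using assms by blast
qed

section \<open>Existence of covering families\<close>

text \<open>This gives meaning to \<open>LEAST\<close> in \<open>D_set\<close> and bounds the set
  under \<open>Max\<close> in \<open>D\<close>. All centres are shifted from their points by the
  same vector \<open>u\<close>, so they are as far apart as the points; a radius of a quarter of the
  separation \<open>\<delta>\<close> is then small enough.\<close>

lemma covering_family_exists:
  assumes "finite P"
  shows "\<exists>F. finite F \<and> card F \<le> card P \<and> covering_family P F"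
proof -
  have "\<exists>\<delta>>0. \<forall>p\<in>P. \<forall>q\<in>P. p \<noteq> q \<longrightarrow> \<delta> \<le> dist p q" using assms
  proof induction
    case (insert a S)
    then obtain \<delta> where \<delta>: "0 < \<delta>" "\<forall>p\<in>S. \<forall>q\<in>S. p \<noteq> q \<longrightarrow> \<delta> \<le> dist p q" by blast
    obtain \<epsilon> where \<epsilon>: "0 < \<epsilon>" "\<forall>x\<in>S. x \<noteq> a \<longrightarrow> \<epsilon> \<le> dist a x" using finite_set_avoid[OF insert(1)] by blast
    then show ?case using \<delta> by (intro exI[of _ "min \<delta> \<epsilon>"]) (auto simp: min_le_iff_disj dist_commute)
  qed (auto intro: exI[of _ 1])
  then obtain \<delta> where \<delta>: "0 < \<delta>" "\<And>p q. p \<in> P \<Longrightarrow> q \<in> P \<Longrightarrow> p \<noteq> q \<Longrightarrow> \<delta> \<le> dist p q" by blast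
  define e where "e = \<delta> / 4"
  have e: "0 < e" "\<delta> = 4 * e" using \<delta> by (auto simp: e_def)
  define u :: "real ^ 2" where "u = e *\<^sub>R axis 1 1"
  have nu: "norm u = e" using e by (simp add: u_def)
  let ?F = "(\<lambda>p. cball (p + u) e) ` P"
  have near: "dist q p < 2 * e" if "dist (p + u) q < e" for p q
    using dist_triangle[of q p "p + u"] that nu by (simp add: dist_commute) (simp add: dist_norm)
  have "covering_family P ?F"
    unfolding covering_family_def disjoint_disks_def
  proof (intro conjI ballI)
    fix A assume "A \<in> ?F"
    then obtain p where p: "p \<in> P" "A = cball (p + u) e" by blast
    have "interior A \<inter> P = {}"
    proof (rule ccontr)
      assume "interior A \<inter> P \<noteq> {}"
      then obtain q where q: "q \<in> P" "dist (p + u) q < e" using p by auto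
      then have "q = p" using near[OF q(2)] \<delta>(2)[of q p] p e by force
      then show False using q nu by (simp add: dist_norm)
    qed
    then show "empty_disk P A" using p e by (auto simp: empty_disk_def is_disk_def)
  next
    show "pairwise (\<lambda>A B. interior A \<inter> interior B = {}) ?F"
    proof (clarsimp simp: pairwise_def)
      fix p q assume pq: "p \<in> P" "q \<in> P" "cball (p + u) e \<noteq> cball (q + u) e"
      then have "p \<noteq> q" by auto
      then have "2 * e \<le> dist (p + u) (q + u)" using \<delta>(2)[of p q] e pq by auto
      then show "ball (p + u) e \<inter> ball (q + u) e = {}" by (intro disjoint_ballI) auto
    qed
  next
    fix p assume "p \<in> P"
    moreover have "p \<in> frontier (cball (p + u) e)" using nu by (simp add: frontier_cball dist_norm)
    ultimately show "\<exists>B\<in>?F. p \<in> frontier B" by blast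
  qed
  moreover have "finite ?F" "card ?F \<le> card P" using assms card_image_le by auto
  ultimately show ?thesis by blast
qed

lemma D_set_le_card: "finite P \<Longrightarrow> D_set P \<le> card P"
proof -
  assume "finite P"
  then obtain F where "finite F" "card F \<le> card P" "covering_family P F" using covering_family_exists by blast
  then have "D_set P \<le> card F" unfolding D_set_def by (intro Least_le) blast
  then show ?thesis using \<open>card F \<le> card P\<close> by simp
qed

lemma D_set_attained: "finite P \<Longrightarrow> \<exists>F. finite F \<and> card F = D_set P \<and> covering_family P F"
  unfolding D_set_def by (rule LeastI_ex) (use covering_family_exists in blast)

lemma D_set_le_D:
  assumes "finite P" "card P = n"
  shows "D_set P \<le> D n"
proof -
  have "{D_set Q | Q. finite Q \<and> card Q = n} \<subseteq> {..n}" using D_set_le_card by auto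
  then have "finite {D_set Q | Q. finite Q \<and> card Q = n}" by (rule finite_subset) auto
  then show ?thesis unfolding D_def using assms by (intro Max_ge) auto
qed

section \<open>Transfer from the complex plane to \<open>real ^ 2\<close>, and the final
  count\<close>

definition vec_of :: "complex \<Rightarrow> real ^ 2" where "vec_of z = vector [Re z, Im z]"

lemma dist_vec_of [simp]: "dist (vec_of a) (vec_of b) = dist a b"
  by (simp add: vec_of_def dist_vec_def L2_set_def sum_2 dist_norm cmod_def)

lemma surj_vec_of: "\<exists>z. v = vec_of z"
  by (rule exI[of _ "Complex (v $ 1) (v $ 2)"]) (simp add: vec_of_def vec_eq_iff forall_2)

lemma centred_polygon_D_set:
  assumes "173 \<le> N"
  shows "N + 1 < 2 * D_set (vec_of ` insert 0 {z. z ^ N = 1})"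
proof -
  define \<theta> where "\<theta> = 2 * pi / of_int (int N)"
  let ?P = "vec_of ` insert 0 {z. z ^ N = 1}"
  have "finite ?P" using assms by (simp add: finite_roots_unity)
  then obtain F where F: "finite F" "card F = D_set ?P" "covering_family ?P F" using D_set_attained by blast
  have "\<exists>z r. 0 < r \<and> A = cball (vec_of z) r" if "A \<in> F" for A
    using F that surj_vec_of unfolding covering_family_def empty_disk_def is_disk_def by metis
  then obtain z r where zr: "\<And>A. A \<in> F \<Longrightarrow> 0 < r A" "\<And>A. A \<in> F \<Longrightarrow> A = cball (vec_of (z A)) (r A)" by metis
  define G where "G = (\<lambda>A. (z A, r A)) ` F"
  have root: "cis (of_int k * \<theta>) ^ N = 1" for k :: int
  proof -
    have "cis (of_int k * \<theta>) ^ N = cis (real N * (of_int k * \<theta>))" by (rule Complex.DeMoivre)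
    also have "real N * (of_int k * \<theta>) = 2 * pi * of_int k" using assms by (simp add: \<theta>_def)
    finally show ?thesis by (simp add: cis_multiple_2pi)
  qed
  have mem: "vec_of 0 \<in> ?P" "vec_of (cis (of_int k * \<theta>)) \<in> ?P" for k :: int using root by auto
  have empty: "r A \<le> dist (z A) w" if "A \<in> F" "vec_of w \<in> ?P" for A w
  proof -
    have "interior A \<inter> ?P = {}" using F(3) that(1) by (auto simp: covering_family_def empty_disk_def)
    then have "vec_of w \<notin> ball (vec_of (z A)) (r A)" using zr(2)[OF that(1)] that(2) by (metis disjoint_iff interior_cball)
    then show ?thesis by simp
  qed
  have touch: "\<exists>A\<in>F. dist (z A) w = r A" if w: "vec_of w \<in> ?P" for w
  proof -
    obtain A where "A \<in> F" "vec_of w \<in> frontier A" using F(3) w unfolding covering_family_def by blast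
    then show ?thesis using zr by (metis dist_vec_of frontier_cball mem_sphere)
  qed
  obtain A where A: "A \<in> F" "dist (z A) 0 = r A" using touch[OF mem(1)] by blast
  have "int N + 1 < 2 * int (card G)"
  proof (rule centred_polygon_disks[OF _ \<theta>_def])
    show "173 \<le> int N" "finite G" using assms F by (auto simp: G_def)
    show "(z A, r A) \<in> G" "norm (fst (z A, r A)) = snd (z A, r A)" using A by (auto simp: G_def)
    show "\<exists>X\<in>G. dist (fst X) (cis (of_int k * \<theta>)) = snd X" for k using touch[OF mem(2)] by (auto simp: G_def)
    show "0 < snd X" "snd X \<le> norm (fst X)" "snd X \<le> dist (fst X) (cis (of_int k * \<theta>))" if "X \<in> G" for X k
      using that zr empty[OF _ mem(1)] empty[OF _ mem(2)] by (auto simp: G_def)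
    show "snd X + snd Y \<le> dist (fst X) (fst Y)" if XY: "X \<in> G" "Y \<in> G" "X \<noteq> Y" for X Y
    proof -
      obtain U V where UV: "U \<in> F" "V \<in> F" "X = (z U, r U)" "Y = (z V, r V)" using XY by (auto simp: G_def)
      then have "U \<noteq> V" using XY by auto
      then have "interior U \<inter> interior V = {}"
        using F(3) UV unfolding covering_family_def disjoint_disks_def pairwise_def by blast
      then have "ball (vec_of (z U)) (r U) \<inter> ball (vec_of (z V)) (r V) = {}"
        using zr(2) UV by (metis interior_cball)
      then show ?thesis using dist_ge_of_disjoint_balls[of "r U" "r V"] zr(1) UV by fastforce
    qed
  qed
  moreover have "card G \<le> card F" unfolding G_def using F by (intro card_image_le)
  ultimately show ?thesis using F by linarith
qed

theorem theorem1:
  fixes n :: nat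
  assumes "even n" and "n \<ge> 174"
  shows "real (D n) \<ge> real n / 2 + 1"
proof -
  obtain N where N: "n = N + 1" using assms by (metis add.commute le_add_diff_inverse one_le_numeral order_trans)
  let ?R = "{z::complex. z ^ N = 1}"
  have "N \<noteq> 0" using N assms by auto
  have "0 \<notin> ?R" using \<open>N \<noteq> 0\<close> by (simp add: power_0_left)
  then have "card (insert 0 ?R) = Suc (card ?R)"
    using finite_roots_unity[of N] \<open>N \<noteq> 0\<close> by (intro card_insert_disjoint) auto
  then have "card (insert 0 ?R) = n"
    using card_roots_unity_eq[of N] N \<open>N \<noteq> 0\<close> by simp
  moreover have "inj vec_of" by (metis dist_eq_0_iff dist_vec_of injI)
  ultimately have "card (vec_of ` insert 0 ?R) = n" by (metis card_image inj_on_subset subset_UNIV)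
  moreover have "finite (vec_of ` insert 0 ?R)" using finite_roots_unity[of N] \<open>N \<noteq> 0\<close>
    by (intro finite_imageI) auto
  ultimately have "D_set (vec_of ` insert 0 ?R) \<le> D n" by (intro D_set_le_D)
  moreover have "N + 1 < 2 * D_set (vec_of ` insert 0 ?R)"
    using assms N by (intro centred_polygon_D_set) auto
  ultimately have "n < 2 * D n" using N by linarith
  \<comment> \<open>Parity enters here: an even number exceeding the even \<open>n\<close> is at
    least \<open>n + 2\<close>.\<close>
  then have "n + 2 \<le> 2 * D n" using assms(1) by presburger
  then show ?thesis by linarith
qed

end
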